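(* For every positive integer $n>2$ there is a prime number $p$ with $7n<p<8n$. *)

theory Defs
  imports "HOL-Computational_Algebra.Primes"
begin

end

theory Submission
  imports Defs "HOL-Number_Theory.Prime_Powers" "HOL-Analysis.Harmonic_Numbers"
begin

text \<open>
  The argument is Chebyshev's. With \<open>T(x) = ln \<lfloor>x\<rfloor>! = \<Sum>m. \<Lambda>(m) \<lfloor>x/m\<rfloor>\<close>, choose integers
  \<open>c\<^sub>a\<close> and \<open>d\<^sub>a\<close>, for \<open>a\<close> dividing \<open>210\<close>, with \<open>\<Sum>a. (8 c\<^sub>a + 7 d\<^sub>a) / a = 0\<close>. Then
  \<open>\<Sum>a. c\<^sub>a T(8n/a) + d\<^sub>a T(7n/a) = \<Sum>m. \<Lambda>(m) w(n/m)\<close> with a periodic weight \<open>w\<close>, and by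
  Stirling it equals \<open>C n + O(ln n)\<close>. The coefficients are chosen such that \<open>C > 0.41\<close> while
  \<open>w(n/m) \<le> 0\<close> for \<open>m \<le> 7n\<close>, except that \<open>w(n/m) \<le> 2\<close> is allowed for \<open>m \<le> 8n/100\<close>, and
  \<open>w(n/m) \<le> 1\<close> for \<open>7n < m \<le> 8n\<close>. The small \<open>m\<close> contribute at most \<open>2 \<psi>(8n/100) \<le> 0.24 n + O(1)\<close>,
  so \<open>\<psi>(8n) - \<psi>(7n) \<ge> 0.17 n - O(ln n)\<close>. Proper prime powers account for only \<open>O(\<surd>n ln n)\<close> of
  this, which leaves a prime for \<open>n \<ge> 2\<^sup>1\<^sup>5\<close>; smaller \<open>n\<close> are covered by an explicit chain of primes.
\<close>

section \<open>Logarithms of factorials\<close>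

definition psi :: "nat \<Rightarrow> real" where
  "psi n = (\<Sum>m=1..n. mangoldt m)"

lemma psi_mono: "m \<le> n \<Longrightarrow> psi m \<le> psi n"
  unfolding psi_def by (intro sum_mono2) (auto simp: mangoldt_nonneg)

text \<open>Passing from \<open>N\<close> to \<open>Suc N\<close> adds ln (N+1), the sum of
  \<Lambda>(d) over the divisors d of N+1, and \<open>Suc N div m\<close> exceeds
  \<open>N div m\<close> by one exactly when m divides N+1. The free upper limit \<open>M\<close>
  lets factorials of different sizes share one range of summation.\<close>

lemma ln_fact_eq_sum_mangoldt:
  assumes "N \<le> M"
  shows "ln (fact N :: real) = (\<Sum>m=1..M. mangoldt m * real (N div m))"
  using assms
proof (induction N)
  case 0
  then show ?case by simp
next
  case (Suc N)
  have "d \<le> M" if "d dvd Suc N" for d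
    using dvd_imp_le[OF that] Suc.prems by simp
  hence divisors: "{d. d dvd Suc N} = {d \<in> {1..M}. d dvd Suc N}"
    by (auto simp: Suc_le_eq intro: Nat.gr0I)
  have "ln (fact (Suc N) :: real) = ln (real (Suc N)) + ln (fact N)"
    unfolding fact_Suc by (rule ln_mult_pos) (auto simp del: of_nat_Suc)
  also have "ln (real (Suc N)) = (\<Sum>d | d dvd Suc N. mangoldt d)"
    by (subst mangoldt_sum) (auto simp del: of_nat_Suc)
  also have "{d. d dvd Suc N} = {d \<in> {1..M}. d dvd Suc N}" by (rule divisors)
  also have "(\<Sum>d\<in>\<dots>. mangoldt d) = (\<Sum>d=1..M. if d dvd Suc N then mangoldt d else (0 :: real))"
    by (subst sum.inter_filter) auto
  also have "ln (fact N :: real) = (\<Sum>m=1..M. mangoldt m * real (N div m))"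
    using Suc by simp
  also have "(\<Sum>d=1..M. if d dvd Suc N then mangoldt d else (0 :: real)) + \<dots> =
      (\<Sum>m=1..M. mangoldt m * real (Suc N div m))"
    unfolding sum.distrib [symmetric]
    by (intro sum.cong refl) (auto simp: div_Suc dvd_eq_mod_eq_0 algebra_simps)
  finally show ?case .
qed

definition stirling_main :: "real \<Rightarrow> real" where
  "stirling_main x = x * ln x - x"

text \<open>The two inductive steps reduce to N ln(1 + 1/N) \<le> 1 \<le> (N+1) ln(1 + 1/N), and
  both halves are instances of ln x \<le> x - 1.\<close>

lemma ln_fact_bounds:
  assumes "N \<ge> 1"
  shows "stirling_main (real N) + 1 \<le> ln (fact N)"
    and "ln (fact N) \<le> stirling_main (real N) + 1 + ln (real N)"
  using assms
proof (induction N rule: dec_induct)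
  case base
  { case 1 show ?case by (simp add: stirling_main_def)
  next
    case 2 show ?case by (simp add: stirling_main_def) }
next
  case (step N)
  have N: "real N > 0" using step by simp
  have fact: "ln (fact (Suc N) :: real) = ln (real N + 1) + ln (fact N)"
    unfolding fact_Suc by (subst ln_mult_pos) (auto simp: add_ac)
  have "ln ((real N + 1) / real N) \<le> (real N + 1) / real N - 1"
    using N by (intro ln_le_minus_one) auto
  also have "\<dots> = 1 / real N" using N by (simp add: field_simps)
  finally have up: "real N * (ln (real N + 1) - ln (real N)) \<le> 1"
    using N by (simp add: ln_div field_simps)
  have "ln (real N / (real N + 1)) \<le> real N / (real N + 1) - 1"
    using N by (intro ln_le_minus_one) auto
  also have "\<dots> = - 1 / (real N + 1)" using N by (simp add: field_simps)
  finally have "ln (real N) - ln (real N + 1) \<le> - 1 / (real N + 1)"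
    using N by (subst (asm) ln_div) auto
  hence lo: "(real N + 1) * (ln (real N + 1) - ln (real N)) \<ge> 1"
    using N by (simp add: field_simps)
  { case 1
    show ?case using step.IH(1) up unfolding fact stirling_main_def
      by (simp add: algebra_simps)
  next
    case 2
    show ?case using step.IH(2) lo unfolding fact stirling_main_def
      by (simp add: algebra_simps) }
qed

text \<open>The derivative of \<open>stirling_main\<close> is ln, which lies between 0 and ln x on
  [y, x], an interval of length at most 1. Tangent inequalities for ln replace the calculus.\<close>

lemma stirling_main_floor:
  assumes "1 \<le> y" "y \<le> x" "x \<le> y + 1"
  shows "stirling_main y \<le> stirling_main x"
    and "stirling_main x \<le> stirling_main y + ln x"
proof -
  have "ln (y / x) \<le> y / x - 1" using assms by (intro ln_le_minus_one) auto
  hence "x * ln (y / x) \<le> x * (y / x - 1)" using assms by (intro mult_left_mono) auto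
  hence *: "x * (ln y - ln x) \<le> y - x" using assms by (simp add: ln_div right_diff_distrib)
  have "0 \<le> (x - y) * ln y" using assms by simp
  with * show "stirling_main y \<le> stirling_main x"
    by (simp add: stirling_main_def algebra_simps)
  have "ln (x / y) \<le> x / y - 1" using assms by (intro ln_le_minus_one) auto
  hence "y * ln (x / y) \<le> y * (x / y - 1)" using assms by (intro mult_left_mono) auto
  hence *: "y * (ln x - ln y) \<le> x - y" using assms by (simp add: ln_div right_diff_distrib)
  have "(x - y) * ln x \<le> 1 * ln x" using assms by (intro mult_right_mono) auto
  with * show "stirling_main x \<le> stirling_main y + ln x"
    by (simp add: stirling_main_def algebra_simps)
qed

text \<open>Rounding the quotient down changes the main term by between -ln x and 0, while
  Stirling's error is between 1 and 1 + ln x. The logarithms have opposite signs, so a single one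
  suffices.\<close>

lemma ln_fact_div_approx:
  assumes "0 < a" "a \<le> N"
  shows "\<bar>ln (fact (N div a)) - stirling_main (real N / real a)\<bar> \<le> 1 + ln (real N)"
proof -
  let ?x = "real N / real a" and ?k = "N div a"
  have k: "?k \<ge> 1" using assms by (simp add: div_greater_zero_iff Suc_le_eq)
  have le: "real ?k \<le> ?x" by (rule of_nat_div_le_of_nat)
  have "N < (?k + 1) * a" using assms dividend_less_div_times[of a N] by simp
  hence "real N < (real ?k + 1) * real a"
    by (metis of_nat_1 of_nat_add of_nat_less_iff of_nat_mult)
  hence ge: "?x \<le> real ?k + 1" using assms by (simp add: field_simps)
  have lnk: "ln (real ?k) \<le> ln ?x" using k le by (subst ln_le_cancel_iff) auto
  have lnx: "ln ?x \<le> ln (real N)"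
    using assms k le by (subst ln_le_cancel_iff) (auto simp: field_simps)
  show ?thesis
    using ln_fact_bounds[OF k] stirling_main_floor[OF _ le ge] lnk lnx k by simp
qed

section \<open>A crude upper bound for the Chebyshev function\<close>

text \<open>The logarithm of the central binomial coefficient, at most 2k ln 2, gives \<Lambda>(m)
  the weight \<open>2 * k div m - 2 * (k div m)\<close>. This is never negative, and it is at least
  1 for k < m \<le> 2k.\<close>

lemma psi_double: "psi (2 * k) \<le> psi k + 2 * real k * ln 2"
proof -
  have "fact (2 * k) = (fact k * fact k * real (2 * k choose k))"
    using binomial_fact_lemma[of k "2 * k"]
    by (metis le_add1 mult_2 add_diff_cancel_left' of_nat_fact of_nat_mult)
  hence "ln (fact (2 * k)) = 2 * ln (fact k) + ln (real (2 * k choose k))"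
    by (simp add: ln_mult_pos)
  also have "ln (real (2 * k choose k)) \<le> ln (2 ^ (2 * k))"
  proof (subst ln_le_cancel_iff)
    have "(2 * k choose k) \<le> 2 ^ (2 * k)" by (rule binomial_le_pow2)
    thus "real (2 * k choose k) \<le> 2 ^ (2 * k)"
      by (metis of_nat_le_iff of_nat_numeral of_nat_power)
  qed auto
  also have "ln (2 ^ (2 * k) :: real) = 2 * real k * ln 2"
    by (simp add: ln_realpow)
  finally have "ln (fact (2 * k) :: real) - 2 * ln (fact k) \<le> 2 * real k * ln 2" by simp
  moreover have "ln (fact (2 * k) :: real) - 2 * ln (fact k) =
      (\<Sum>m=1..2*k. mangoldt m * (real (2 * k div m) - 2 * real (k div m)))"
    by (subst (1 2) ln_fact_eq_sum_mangoldt[where M = "2 * k"])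
       (auto simp: sum_subtractf sum_distrib_left algebra_simps)
  moreover have "\<dots> \<ge> (\<Sum>m=1..2*k. if m > k then mangoldt m else 0)"
  proof (intro sum_mono)
    fix m assume m: "m \<in> {1..2*k}"
    have le: "2 * (k div m) \<le> 2 * k div m"
      by (metis mult.commute m atLeastAtMost_iff
          div_times_less_eq_dividend less_eq_div_iff_mult_less_eq mult.assoc mult_le_mono2
          zero_less_one order_less_le_trans)
    show "(if m > k then mangoldt m else 0) \<le>
        mangoldt m * (real (2 * k div m) - 2 * real (k div m))"
    proof (cases "m > k")
      case True
      hence "2 * k div m \<ge> 1" using m by (simp add: less_eq_div_iff_mult_less_eq)
      hence "mangoldt m * 1 \<le> mangoldt m * real (2 * k div m)"
        by (intro mult_left_mono mangoldt_nonneg) simp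
      thus ?thesis using True by simp
    next
      case False
      have "real (2 * (k div m)) \<le> real (2 * k div m)" using le by (simp only: of_nat_le_iff)
      thus ?thesis using False by (simp add: mangoldt_nonneg)
    qed
  qed
  moreover have "psi (2 * k) = psi k + (\<Sum>m=1..2*k. if m > k then mangoldt m else 0)"
  proof -
    have "psi k = (\<Sum>m=1..2*k. if m > k then 0 else mangoldt m)"
      unfolding psi_def by (intro sum.mono_neutral_cong_left) auto
    thus ?thesis
      unfolding psi_def by (auto simp: sum.distrib [symmetric] intro!: sum.cong)
  qed
  ultimately show ?thesis by linarith
qed

lemma mangoldt_le_ln: "n > 0 \<Longrightarrow> mangoldt n \<le> ln (real n)"
proof -
  assume n: "n > 0"
  have "(\<Sum>d\<in>{n}. mangoldt d) \<le> (\<Sum>d | d dvd n. mangoldt d :: real)"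
    using n by (intro sum_mono2) (auto simp: mangoldt_nonneg)
  thus ?thesis using n by (subst (asm) mangoldt_sum) auto
qed

lemma psi_halve:
  assumes "n > 0"
  shows "psi n \<le> psi (n div 2) + real n * ln 2 + ln (real n)"
proof (cases "even n")
  case True
  then obtain k where "n = 2 * k" by blast
  moreover have "ln (real n) \<ge> 0" using assms by simp
  ultimately show ?thesis using psi_double[of k] by simp
next
  case False
  then obtain k where k: "n = 2 * k + 1" by (blast elim: oddE)
  have "psi n = psi (2 * k) + mangoldt n" by (simp add: psi_def k)
  moreover have "mangoldt n \<le> ln (real n)" using assms by (rule mangoldt_le_ln)
  moreover have "real n * ln 2 = 2 * real k * ln 2 + ln 2" by (simp add: k algebra_simps)
  moreover have "psi (n div 2) = psi k" by (simp add: k)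
  moreover have "0 \<le> ln (2::real)" by simp
  ultimately show ?thesis using psi_double[of k] by linarith
qed

lemma ln2_bounds: "693 / 1000 \<le> ln (2::real)" "ln (2::real) \<le> 6932 / 10000"
  using ln_approx_bounds[of 2 3] by (simp_all add: eval_nat_numeral)

lemma psi_pow2: "psi (2 ^ k) \<le> 2 ^ (k + 1) * ln 2"
proof (induction k)
  case 0
  then show ?case by (simp add: psi_def)
next
  case (Suc k)
  then show ?case using psi_double[of "2 ^ k"] by simp
qed

lemma ln_le_tangent: "0 < a \<Longrightarrow> 0 < x \<Longrightarrow> ln x \<le> ln a + x / a - (1::real)"
  using ln_le_minus_one[of "x / a"] by (simp add: ln_div)

text \<open>Repeated halving alone would give slope 2 ln 2 < 1.39; the slope 3/2 leaves room to
  absorb the logarithm from \<open>psi_halve\<close> once n > 128. The constant 178 covers 256 ln 2,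
  the bound for \<open>psi\<close> at 128.\<close>

lemma psi_le: "psi n \<le> 3 / 2 * real n + 178"
proof (induction n rule: less_induct)
  case (less n)
  show ?case
  proof (cases "n \<le> 128")
    case True
    hence "psi n \<le> psi (2 ^ 7)" by (intro psi_mono) simp
    also have "\<dots> \<le> 256 * ln 2" using psi_pow2[of 7] by simp
    finally show ?thesis using ln2_bounds by simp
  next
    case False
    have "ln (real n) \<le> ln (2 ^ 7) + real n / 128 - 1"
      using False ln_le_tangent[of 128 "real n"] by simp
    also have "ln (2 ^ 7 :: real) = 7 * ln 2" by (subst ln_realpow) auto
    finally have ln: "ln (real n) \<le> 7 * ln 2 + real n / 128 - 1" .
    have "real n * ln 2 \<le> real n * (6932 / 10000)" using ln2_bounds by (intro mult_left_mono) auto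
    moreover have "real (n div 2) \<le> real n / 2" using of_nat_div_le_of_nat[of n 2] by simp
    moreover have "psi (n div 2) \<le> 3 / 2 * real (n div 2) + 178"
      using False by (intro less) auto
    moreover have "psi n \<le> psi (n div 2) + real n * ln 2 + ln (real n)"
      using False by (intro psi_halve) simp
    moreover have "real n > 128" using False by simp
    ultimately show ?thesis using ln ln2_bounds by linarith
  qed
qed

section \<open>Linear combinations of logarithms of factorials\<close>

definition floor_comb :: "(int \<times> int) list \<Rightarrow> int \<Rightarrow> int" where
  "floor_comb cs q = (\<Sum>(a, c)\<leftarrow>cs. c * (q div a))"

definition ln_fact_comb :: "(int \<times> int) list \<Rightarrow> nat \<Rightarrow> real" where
  "ln_fact_comb cs N = (\<Sum>(a, c)\<leftarrow>cs. of_int c * ln (fact (N div nat a)))"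

text \<open>Nested floor divisions commute, so the weight of \<Lambda>(m) depends on m only through
  the integer \<open>N div m\<close>. This makes the later weight bound a finite check.\<close>

lemma ln_fact_comb_eq_sum_mangoldt:
  assumes "\<forall>(a, c)\<in>set cs. a > 0" "N \<le> M"
  shows "ln_fact_comb cs N = (\<Sum>m=1..M. mangoldt m * of_int (floor_comb cs (int (N div m))))"
  using assms(1)
proof (induction cs)
  case Nil
  then show ?case by (simp add: ln_fact_comb_def floor_comb_def)
next
  case (Cons ac cs)
  obtain a c where ac: "ac = (a, c)" by fastforce
  have a: "a > 0" using Cons.prems ac by simp
  have le: "N div nat a \<le> M" using assms(2) by (meson div_le_dividend order_trans)
  have eq: "real (N div nat a div m) = real_of_int (int (N div m) div a)" for m
  proof -
    have "N div nat a div m = N div m div nat a" by (simp add: div_mult2_eq [symmetric] mult.commute)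
    moreover have "int (N div m div nat a) = int (N div m) div a"
      using a by (simp add: zdiv_int)
    ultimately show ?thesis by (metis of_int_of_nat_eq)
  qed
  have "ln_fact_comb (ac # cs) N = of_int c * ln (fact (N div nat a)) + ln_fact_comb cs N"
    by (simp add: ln_fact_comb_def ac)
  also have "of_int c * ln (fact (N div nat a)) =
      (\<Sum>m=1..M. mangoldt m * (of_int c * real_of_int (int (N div m) div a)))"
    by (subst ln_fact_eq_sum_mangoldt[OF le]) (simp add: eq sum_distrib_left algebra_simps)
  also have "ln_fact_comb cs N = (\<Sum>m=1..M. mangoldt m * of_int (floor_comb cs (int (N div m))))"
    using Cons by simp
  finally show ?case
    by (simp add: ac floor_comb_def sum.distrib [symmetric] algebra_simps)
qed

lemma ln_fact_comb_approx:
  assumes "\<forall>(a, c)\<in>set cs. 0 < a \<and> a \<le> int N"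
  shows "\<bar>ln_fact_comb cs N - (\<Sum>(a, c)\<leftarrow>cs. of_int c * stirling_main (real N / of_int a))\<bar>
    \<le> (\<Sum>(a, c)\<leftarrow>cs. \<bar>of_int c\<bar>) * (1 + ln (real N))"
  using assms
proof (induction cs)
  case Nil
  then show ?case by (simp add: ln_fact_comb_def)
next
  case (Cons ac cs)
  obtain a c where ac: "ac = (a, c)" by fastforce
  have a: "0 < nat a" "nat a \<le> N" and ra: "real (nat a) = of_int a" using Cons.prems ac by auto
  have "\<bar>of_int c * (ln (fact (N div nat a)) - stirling_main (real N / of_int a))\<bar>
      \<le> \<bar>of_int c\<bar> * (1 + ln (real N))"
    using ln_fact_div_approx[OF a] unfolding abs_mult ra by (intro mult_left_mono) auto
  moreover have "\<bar>ln_fact_comb cs N - (\<Sum>(a, c)\<leftarrow>cs. of_int c * stirling_main (real N / of_int a))\<bar>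
    \<le> (\<Sum>(a, c)\<leftarrow>cs. \<bar>of_int c\<bar>) * (1 + ln (real N))"
    using Cons by auto
  ultimately show ?case
    by (simp add: ac ln_fact_comb_def algebra_simps)
qed

text \<open>Expanding ln(x/a) isolates the coefficient of x ln x, so that it can be cancelled
  between two lists, from the linear term that remains.\<close>

lemma sum_stirling_main:
  assumes "\<forall>(a, c)\<in>set cs. a > 0" "x > 0"
  shows "(\<Sum>(a, c)\<leftarrow>cs. of_int c * stirling_main (x / of_int a)) =
    x * ((ln x - 1) * (\<Sum>(a, c)\<leftarrow>cs. of_int c / of_int a)
         - (\<Sum>(a, c)\<leftarrow>cs. of_int c / of_int a * ln (of_int a)))"
  using assms
proof (induction cs)
  case Nil
  then show ?case by simp
next
  case (Cons ac cs)
  obtain a c where ac: "ac = (a, c)" by fastforce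
  have "of_int c * stirling_main (x / of_int a) =
      x * ((ln x - 1) * (of_int c / of_int a) - of_int c / of_int a * ln (of_int a))"
    using Cons.prems by (simp add: ac stirling_main_def ln_div algebra_simps add_divide_distrib diff_divide_distrib)
  moreover note Cons.IH
  ultimately show ?case using Cons.prems by (simp add: ac algebra_simps)
qed

text \<open>As a divides L, adding L t to the argument shifts each quotient by exactly t
  (L/a).\<close>

lemma floor_comb_add_period:
  assumes "\<forall>(a, c)\<in>set cs. a \<noteq> 0 \<and> a dvd L"
  shows "floor_comb cs (L * t + q) = t * (\<Sum>(a, c)\<leftarrow>cs. c * (L div a)) + floor_comb cs q"
  using assms
  by (induction cs) (auto simp: floor_comb_def algebra_simps elim!: dvdE)

section \<open>The particular combination\<close>

text \<open>
  The lists consist of pairs \<open>(a, c\<^sub>a)\<close> and \<open>(a, d\<^sub>a)\<close>. They were found by linear programming,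
  maximising the main term minus the loss from small \<open>m\<close>, subject to the bound on the weight.
\<close>

definition coeffs8 :: "(int \<times> int) list" where
  "coeffs8 = [(1, 1), (2, -1), (3, -1), (5, -1), (6, 1), (7, -1), (14, 1), (15, 1), (21, 3),
     (30, -1), (35, 1), (42, -2), (70, -1), (105, -1), (210, 1)]"

definition coeffs7 :: "(int \<times> int) list" where
  "coeffs7 = [(1, -1), (2, 1), (3, 1), (5, 1), (6, -1), (7, 1), (10, -1), (14, -1), (15, -2),
     (21, -1), (30, 3), (35, -2), (42, 1), (70, 2), (105, 3), (210, -2)]"

definition weight :: "int \<Rightarrow> int \<Rightarrow> int" where
  "weight q8 q7 = floor_comb coeffs8 q8 + floor_comb coeffs7 q7"

text \<open>
  The listed pairs are the possible values of \<open>(8 * r div m, 7 * r div m)\<close> for \<open>r < m\<close>, and \<open>k\<close>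
  stands for \<open>n div m\<close>.
\<close>

lemma weight_le_one_period:
  "list_all (\<lambda>k. list_all (\<lambda>(i, j). weight (8 * k + i) (7 * k + j)
       \<le> (if 7 * k + j = 0 then 1 else 0) + (if 8 * k + i \<ge> 100 then 2 else 0))
     [(0, 0), (1, 0), (1, 1), (2, 1), (2, 2), (3, 2), (3, 3),
      (4, 3), (4, 4), (5, 4), (5, 5), (6, 5), (6, 6), (7, 6)]) [0..209]"
  by code_simp

text \<open>The shifts are 8 * 210 t and 7 * 210 t. The drifts 336 t and -336 t cancel, which is the
  integer form of the balance condition on the coefficients.\<close>

lemma weight_periodic: "weight (1680 * t + q8) (1470 * t + q7) = weight q8 q7"
proof -
  have "floor_comb coeffs8 (1680 * t + q8) = t * 336 + floor_comb coeffs8 q8"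
    by (subst floor_comb_add_period) (simp_all add: coeffs8_def)
  moreover have "floor_comb coeffs7 (1470 * t + q7) = t * (- 336) + floor_comb coeffs7 q7"
    by (subst floor_comb_add_period) (simp_all add: coeffs7_def)
  ultimately show ?thesis by (simp add: weight_def)
qed

lemma weight_le:
  assumes "m > 0"
  shows "weight (int (8 * n div m)) (int (7 * n div m))
    \<le> (if 7 * n < m then 1 else 0) + (if 8 * n div m \<ge> 100 then 2 else 0)"
proof -
  define k r where "k = n div m" and "r = n mod m"
  define i j where "i = 8 * r div m" and "j = 7 * r div m"
  define t k0 where "t = k div 210" and "k0 = k mod 210"
  have n: "n = k * m + r" by (simp add: k_def r_def)
  have r: "r < m" using assms by (simp add: r_def)
  have n8: "8 * n = 8 * r + 8 * k * m" and n7: "7 * n = 7 * r + 7 * k * m" by (simp_all add: n)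
  have q8: "8 * n div m = 8 * k + i" unfolding n8 i_def using assms by simp
  have q7: "7 * n div m = 7 * k + j" unfolding n7 j_def using assms by simp
  have i: "i * m \<le> 8 * r" "8 * r < (i + 1) * m"
    using assms dividend_less_div_times[of m "8 * r"] by (simp_all add: i_def)
  have j: "j * m \<le> 7 * r" "7 * r < (j + 1) * m"
    using assms dividend_less_div_times[of m "7 * r"] by (simp_all add: j_def)
  have "i * m < 8 * m" "j * m < 7 * m" using i j r by linarith+
  hence ij: "i < 8" "j < 7" by simp_all
  \<comment> \<open>Since 8r exceeds 7r by r < m, the two quotients differ by at most one; this
    leaves just the 14 pairs that were tabulated.\<close>
  have "j * m < (i + 1) * m" "i * m < (j + 2) * m" using i j r by (simp_all add: algebra_simps)
  hence ij': "j \<le> i" "i \<le> j + 1" unfolding mult_less_cancel2 by simp_all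
  have mem: "(int i, int j) \<in> set [(0, 0), (1, 0), (1, 1), (2, 1), (2, 2), (3, 2), (3, 3),
      (4, 3), (4, 4), (5, 4), (5, 5), (6, 5), (6, 6), (7, 6)]"
  proof -
    have "j = 0 \<or> j = 1 \<or> j = 2 \<or> j = 3 \<or> j = 4 \<or> j = 5 \<or> j = 6"
      and "i = j \<or> i = j + 1" using ij ij' by linarith+
    thus ?thesis by (elim disjE) simp_all
  qed
  have k: "k = 210 * t + k0" "k0 < 210" by (simp_all add: t_def k0_def)
  have "weight (int (8 * n div m)) (int (7 * n div m)) =
      weight (1680 * int t + (8 * int k0 + int i)) (1470 * int t + (7 * int k0 + int j))"
    unfolding q8 q7 k(1) by (simp add: algebra_simps)
  also have "\<dots> = weight (8 * int k0 + int i) (7 * int k0 + int j)" by (rule weight_periodic)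
  also have "\<dots> \<le> (if 7 * int k0 + int j = 0 then 1 else 0)
      + (if 8 * int k0 + int i \<ge> 100 then 2 else 0)"
  proof -
    have "int k0 \<in> set [0..209]" using k by simp
    from bspec[OF bspec[OF weight_le_one_period[unfolded list_all_iff] this] mem]
    show ?thesis by (simp only: prod.case)
  qed
  also have "\<dots> \<le> (if 7 * n < m then 1 else 0) + (if 8 * n div m \<ge> 100 then 2 else 0)"
  \<comment> \<open>The allowances must be carried from the residue \<open>k0\<close> back to
    \<open>k\<close>. For t > 0 the allowance 2 is always available, and it suffices because the two
    allowances of the residue never occur together.\<close>
  proof (cases "t = 0")
    case True
    have "7 * n < m" if "7 * k + j = 0" using that q7 assms by (simp add: div_eq_0_iff)
    thus ?thesis using True k q8 by auto
  next
    case False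
    hence "8 * n div m \<ge> 100" using k q8 by simp
    moreover have "7 * int k0 + int j = 0 \<Longrightarrow> 8 * int k0 + int i < 100" using ij by simp
    ultimately show ?thesis by auto
  qed
  finally show ?thesis .
qed

lemma ln_fact_comb_coeffs_le:
  "ln_fact_comb coeffs8 (8 * n) + ln_fact_comb coeffs7 (7 * n) \<le>
     psi (8 * n) - psi (7 * n) + 2 * psi (8 * n div 100)"
proof -
  \<comment> \<open>The range up to 8n serves both sums: for m > 7n the quotient
    \<open>7 * n div m\<close> is 0 and contributes nothing.\<close>
  have *: "ln_fact_comb coeffs8 (8 * n) + ln_fact_comb coeffs7 (7 * n) =
    (\<Sum>m=1..8*n. mangoldt m * of_int (weight (int (8 * n div m)) (int (7 * n div m))))"
    by (subst (1 2) ln_fact_comb_eq_sum_mangoldt[where M = "8 * n"])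
       (auto simp: coeffs8_def coeffs7_def weight_def sum.distrib [symmetric] distrib_left)
  also have "\<dots> \<le> (\<Sum>m=1..8*n. (if 7 * n < m then mangoldt m else 0)
      + (if 8 * n div m \<ge> 100 then 2 * mangoldt m else 0))"
  proof (intro sum_mono)
    fix m assume "m \<in> {1..8*n}"
    hence "real_of_int (weight (int (8 * n div m)) (int (7 * n div m)))
      \<le> of_int ((if 7 * n < m then 1 else 0) + (if 8 * n div m \<ge> 100 then 2 else 0))"
      by (subst of_int_le_iff, intro weight_le) simp
    hence "mangoldt m * real_of_int (weight (int (8 * n div m)) (int (7 * n div m)))
      \<le> mangoldt m * of_int ((if 7 * n < m then 1 else 0) + (if 8 * n div m \<ge> 100 then 2 else 0))"
      by (intro mult_left_mono mangoldt_nonneg)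
    thus "mangoldt m * real_of_int (weight (int (8 * n div m)) (int (7 * n div m)))
      \<le> (if 7 * n < m then mangoldt m else 0) + (if 8 * n div m \<ge> 100 then 2 * mangoldt m else 0)"
      by (auto split: if_splits)
  qed
  also have "\<dots> = (\<Sum>m=1..8*n. if 7 * n < m then mangoldt m else 0)
      + (\<Sum>m=1..8*n. if 8 * n div m \<ge> 100 then 2 * mangoldt m else 0)"
    by (rule sum.distrib)
  also have "(\<Sum>m=1..8*n. if 7 * n < m then mangoldt m else 0) = psi (8 * n) - psi (7 * n)"
  proof -
    have "psi (7 * n) = (\<Sum>m=1..8*n. if 7 * n < m then 0 else mangoldt m)"
      unfolding psi_def by (intro sum.mono_neutral_cong_left) auto
    thus ?thesis
      unfolding psi_def by (auto simp: sum_subtractf [symmetric] intro!: sum.cong)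
  qed
  also have "(\<Sum>m=1..8*n. if 8 * n div m \<ge> 100 then 2 * mangoldt m else (0::real)) =
      2 * psi (8 * n div 100)"
  proof -
    have iff: "8 * n div m \<ge> 100 \<longleftrightarrow> m \<le> 8 * n div 100" if "m \<in> {1..8*n}" for m
      using that by (simp add: less_eq_div_iff_mult_less_eq mult.commute)
    have "(\<Sum>m=1..8*n. if 8 * n div m \<ge> 100 then 2 * mangoldt m else (0::real)) =
        (\<Sum>m=1..8*n. if m \<le> 8 * n div 100 then 2 * mangoldt m else 0)"
      by (intro sum.cong refl, subst iff) auto
    also have "\<dots> = (\<Sum>m\<in>{m \<in> {1..8*n}. m \<le> 8 * n div 100}. 2 * mangoldt m)"
      by (rule sum.inter_filter [symmetric]) simp
    also have "{m \<in> {1..8*n}. m \<le> 8 * n div 100} = {1..8 * n div 100}"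
      using div_le_dividend[of "8 * n" 100] by (auto simp del: div_le_dividend)
    finally show ?thesis unfolding psi_def sum_distrib_left .
  qed
  finally show ?thesis .
qed

text \<open>The error factor 42 = 18 + 24 is the sum of the absolute values of all coefficients. The
  bound n \<ge> 30 ensures that every divisor, the largest being 210, is at most 7n.\<close>

lemma ln_fact_comb_coeffs_ge:
  assumes "n \<ge> 30"
  shows "0.41 * real n - 42 * (1 + ln (real (8 * n))) \<le>
    ln_fact_comb coeffs8 (8 * n) + ln_fact_comb coeffs7 (7 * n)"
proof -
  have n: "real n > 0" using assms by simp
  \<comment> \<open>The near-coincidences of 3^12 with 2^19, of 2^7 with 5^3 and of 7^5 with 2^14
    make the tangent bounds sharp. Their directions match the signs with which ln 3, ln 5 and ln 7
    enter the main term.\<close>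
  have "12 * ln (3::real) = ln (3 ^ 12)" by (subst ln_realpow) auto
  also have "\<dots> \<le> ln (2 ^ 19) + 3 ^ 12 / 2 ^ 19 - 1" by (rule ln_le_tangent) auto
  also have "ln (2 ^ 19 :: real) = 19 * ln 2" by (subst ln_realpow) auto
  finally have l3: "ln (3::real) \<le> 1.0988" using ln2_bounds by simp
  have "7 * ln (2::real) = ln (2 ^ 7)" by (subst ln_realpow) auto
  also have "\<dots> \<le> ln (5 ^ 3) + 2 ^ 7 / 5 ^ 3 - 1" by (rule ln_le_tangent) auto
  also have "ln (5 ^ 3 :: real) = 3 * ln 5" by (subst ln_realpow) auto
  finally have l5: "ln (5::real) \<ge> 1.6088" using ln2_bounds by simp
  have "5 * ln (7::real) = ln (7 ^ 5)" by (subst ln_realpow) auto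
  also have "\<dots> \<le> ln (2 ^ 14) + 7 ^ 5 / 2 ^ 14 - 1" by (rule ln_le_tangent) auto
  also have "ln (2 ^ 14 :: real) = 14 * ln 2" by (subst ln_realpow) auto
  finally have l7: "ln (7::real) \<le> 1.9462" using ln2_bounds by simp
  have factor:
    "ln (6::real) = ln 2 + ln 3" "ln (10::real) = ln 2 + ln 5" "ln (14::real) = ln 2 + ln 7"
    "ln (15::real) = ln 3 + ln 5" "ln (21::real) = ln 3 + ln 7" "ln (35::real) = ln 5 + ln 7"
    "ln (30::real) = ln 2 + ln 3 + ln 5" "ln (42::real) = ln 2 + ln 3 + ln 7"
    "ln (70::real) = ln 2 + ln 5 + ln 7" "ln (105::real) = ln 3 + ln 5 + ln 7"
    "ln (210::real) = ln 2 + ln 3 + ln 5 + ln 7"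
    by (simp_all flip: ln_mult_pos)
  have "ln (8::real) = ln (2 ^ 3)" by simp
  also have "\<dots> = 3 * ln 2" by (subst ln_realpow) auto
  finally have ln8: "ln (8::real) = 3 * ln 2" .
  define S8 S7 where
    "S8 = (\<Sum>(a, c)\<leftarrow>coeffs8. of_int c * stirling_main (real (8 * n) / of_int a))" and
    "S7 = (\<Sum>(a, c)\<leftarrow>coeffs7. of_int c * stirling_main (real (7 * n) / of_int a))"
  have S8: "S8 = real (8 * n) * ((ln (real (8 * n)) - 1) * (1 / 5)
      - (\<Sum>(a, c)\<leftarrow>coeffs8. of_int c / of_int a * ln (of_int a)))"
    unfolding S8_def using assms by (subst sum_stirling_main) (auto simp: coeffs8_def)
  have S7: "S7 = real (7 * n) * ((ln (real (7 * n)) - 1) * (- 8 / 35)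
      - (\<Sum>(a, c)\<leftarrow>coeffs7. of_int c / of_int a * ln (of_int a)))"
    unfolding S7_def using assms by (subst sum_stirling_main) (auto simp: coeffs7_def)
  have W8: "(\<Sum>(a, c)\<leftarrow>coeffs8. of_int c / of_int a * ln (of_int a)) =
      - 37 / 105 * ln 2 - 3 / 70 * ln 3 - 11 / 70 * ln 5 + 1 / 30 * ln (7::real)"
    by (simp add: coeffs8_def factor add_divide_distrib diff_divide_distrib)
  have W7: "(\<Sum>(a, c)\<leftarrow>coeffs7. of_int c / of_int a * ln (of_int a)) =
      32 / 105 * ln 2 + 9 / 70 * ln 3 + 2 / 35 * ln 5 + 4 / 105 * ln (7::real)"
    by (simp add: coeffs7_def factor add_divide_distrib diff_divide_distrib)
  have ln8n: "ln (real (8 * n)) = 3 * ln 2 + ln (real n)" and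
    ln7n: "ln (real (7 * n)) = ln 7 + ln (real n)"
    using n by (simp_all add: ln_mult_pos ln8)
  \<comment> \<open>The terms with \<open>ln (real n)\<close> vanish because 8 * (1/5) = 7 *
    (8/35).\<close>
  have "S8 + S7 = real n *
      (192 / 35 * ln 2 - 39 / 70 * ln 3 + 6 / 7 * ln 5 - 32 / 15 * ln 7)"
    unfolding S8 S7 W8 W7 ln8n ln7n unfolding of_nat_mult of_nat_numeral by algebra
  also have "\<dots> \<ge> real n * 0.41"
    using l3 l5 l7 ln2_bounds by (intro mult_left_mono) auto
  finally have main: "S8 + S7 \<ge> 0.41 * real n" by simp
  have "\<bar>ln_fact_comb coeffs8 (8 * n) - S8\<bar>
      \<le> (\<Sum>(a, c)\<leftarrow>coeffs8. \<bar>of_int c\<bar>) * (1 + ln (real (8 * n)))"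
    unfolding S8_def using assms by (intro ln_fact_comb_approx) (auto simp: coeffs8_def)
  also have "(\<Sum>(a, c)\<leftarrow>coeffs8. \<bar>of_int c\<bar>) = (18 :: real)" by (simp add: coeffs8_def)
  finally have e8: "\<bar>ln_fact_comb coeffs8 (8 * n) - S8\<bar> \<le> 18 * (1 + ln (real (8 * n)))" .
  have "\<bar>ln_fact_comb coeffs7 (7 * n) - S7\<bar>
      \<le> (\<Sum>(a, c)\<leftarrow>coeffs7. \<bar>of_int c\<bar>) * (1 + ln (real (7 * n)))"
    unfolding S7_def using assms by (intro ln_fact_comb_approx) (auto simp: coeffs7_def)
  also have "(\<Sum>(a, c)\<leftarrow>coeffs7. \<bar>of_int c\<bar>) = (24 :: real)" by (simp add: coeffs7_def)
  also have "24 * (1 + ln (real (7 * n))) \<le> 24 * (1 + ln (real (8 * n)))" using n by simp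
  finally have e7: "\<bar>ln_fact_comb coeffs7 (7 * n) - S7\<bar> \<le> 24 * (1 + ln (real (8 * n)))" .
  show ?thesis using main e8 e7 by linarith
qed

section \<open>Existence of a prime\<close>

text \<open>Without primes, only powers p^k with k \<ge> 2 contribute, so p \<le> sqrt(8n) and ln p
  \<le> ln(8n)/2. Each p occurs at most once: a further power would be at least twice as large and
  exceed 14n.\<close>

lemma psi_diff_le:
  assumes "\<And>p. prime p \<Longrightarrow> \<not> (7 * n < p \<and> p < 8 * n)"
  shows "psi (8 * n) - psi (7 * n) \<le> sqrt (real (8 * n)) * (ln (real (8 * n)) / 2)"
proof -
  let ?P = "{m \<in> {7 * n<..8 * n}. primepow m}"
  have diff: "psi (8 * n) - psi (7 * n) = (\<Sum>m\<in>{7 * n<..8 * n}. mangoldt m)"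
  proof -
    have "{1..8 * n} = {1..7 * n} \<union> {7 * n<..8 * n}" by auto
    moreover have "sum mangoldt ({1..7 * n} \<union> {7 * n<..8 * n}) =
        psi (7 * n) + (\<Sum>m\<in>{7 * n<..8 * n}. mangoldt m :: real)"
      unfolding psi_def by (intro sum.union_disjoint) auto
    ultimately show ?thesis unfolding psi_def by simp
  qed
  also have "\<dots> = (\<Sum>m\<in>?P. ln (real (aprimedivisor m)))"
    by (intro sum.mono_neutral_cong_right) (auto simp: mangoldt_def)
  finally have eq: "psi (8 * n) - psi (7 * n) = (\<Sum>m\<in>?P. ln (real (aprimedivisor m)))" .
  have decomp: "\<exists>k\<ge>2. prime (aprimedivisor m) \<and> m = aprimedivisor m ^ k" if "m \<in> ?P" for m
  proof -
    from that obtain p k where pk: "prime p" "k > 0" "m = p ^ k"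
      by (auto simp: primepow_def)
    have p: "aprimedivisor m = p" using pk by (simp add: aprimedivisor_prime_power)
    have "k \<noteq> 1"
    proof
      assume "k = 1"
      hence "m = p" using pk by simp
      \<comment> \<open>The hypothesis excludes primes from the open interval only, whereas the
        difference of \<open>psi\<close> includes the endpoint 8n.\<close>
      moreover have "\<not> prime (8 * n)"
        using prime_product[of 8 n] by (auto dest: prime_ge_2_nat)
      ultimately show False using assms[of p] that pk by (cases "p = 8 * n") auto
    qed
    thus ?thesis using pk p by (intro exI[of _ k]) auto
  qed
  have sq: "aprimedivisor m ^ 2 \<le> 8 * n" "aprimedivisor m \<ge> 2" if "m \<in> ?P" for m
  proof -
    from decomp[OF that] obtain k where k: "k \<ge> 2" "prime (aprimedivisor m)" "m = aprimedivisor m ^ k"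
      by blast
    show ge: "aprimedivisor m \<ge> 2" using k by (simp add: prime_ge_2_nat)
    have "aprimedivisor m ^ 2 \<le> aprimedivisor m ^ k"
      using ge k(1) by (intro power_increasing) auto
    thus "aprimedivisor m ^ 2 \<le> 8 * n" using k(3) that by auto
  qed
  have inj: "inj_on aprimedivisor ?P"
  proof (rule inj_onI)
    have *: False
      if m: "m \<in> ?P" and m': "m' \<in> ?P" and same: "aprimedivisor m = aprimedivisor m'"
        and less: "m < m'" for m m'
    proof -
      obtain k where k: "m = aprimedivisor m ^ k" using decomp[OF m] by blast
      obtain k' where k': "m' = aprimedivisor m ^ k'" using decomp[OF m'] same by auto
      have p: "aprimedivisor m \<ge> 2" using sq m by blast
      have "aprimedivisor m ^ k < aprimedivisor m ^ k'" using less k k' by argo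
      hence "k < k'" by (rule power_less_imp_less_exp[rotated]) (use p in simp)
      hence "aprimedivisor m ^ Suc k \<le> aprimedivisor m ^ k'"
        using p by (intro power_increasing) auto
      hence "aprimedivisor m * m \<le> m'" using k k' by (metis power_Suc)
      hence "2 * m \<le> m'" using p by (meson mult_le_mono1 order_trans)
      thus False using m m' by auto
    qed
    fix m m' assume "m \<in> ?P" "m' \<in> ?P" "aprimedivisor m = aprimedivisor m'"
    thus "m = m'" using *[of m m'] *[of m' m] by (metis linorder_neqE_nat)
  qed
  have "(\<Sum>m\<in>?P. ln (real (aprimedivisor m))) \<le> (\<Sum>m\<in>?P. ln (real (8 * n)) / 2)"
  proof (intro sum_mono)
    fix m assume m: "m \<in> ?P"
    have le: "real (aprimedivisor m ^ 2) \<le> real (8 * n)"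
      using sq(1)[OF m] by (simp only: of_nat_le_iff)
    have pos: "0 < real (aprimedivisor m ^ 2)" using sq(2)[OF m] by simp
    have "2 * ln (real (aprimedivisor m)) = ln (real (aprimedivisor m ^ 2))"
      using sq(2)[OF m] by (simp add: ln_realpow)
    also have "\<dots> \<le> ln (real (8 * n))"
      using pos le by (subst ln_le_cancel_iff) linarith+
    finally show "ln (real (aprimedivisor m)) \<le> ln (real (8 * n)) / 2" by simp
  qed
  also have "\<dots> = real (card ?P) * (ln (real (8 * n)) / 2)" by simp
  also have "\<dots> \<le> sqrt (real (8 * n)) * (ln (real (8 * n)) / 2)"
  proof (cases "n = 0")
    case False
    have "aprimedivisor ` ?P \<subseteq> {1..nat \<lfloor>sqrt (real (8 * n))\<rfloor>}"
    proof safe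
      fix m assume "m \<in> {7 * n<..8 * n}" "primepow m"
      hence m: "m \<in> ?P" by simp
      have "real (aprimedivisor m) \<le> sqrt (real (8 * n))"
        using sq(1)[OF m]
        by (intro real_le_rsqrt) (simp only: of_nat_power [symmetric] of_nat_le_iff)
      thus "aprimedivisor m \<in> {1..nat \<lfloor>sqrt (real (8 * n))\<rfloor>}"
        using sq(2)[OF m] by (simp add: le_nat_floor)
    qed
    hence "card (aprimedivisor ` ?P) \<le> nat \<lfloor>sqrt (real (8 * n))\<rfloor>"
      by (metis card_atLeastAtMost card_mono diff_Suc_1 finite_atLeastAtMost)
    hence "card ?P \<le> nat \<lfloor>sqrt (real (8 * n))\<rfloor>" unfolding card_image[OF inj] .
    also have "real (nat \<lfloor>sqrt (real (8 * n))\<rfloor>) \<le> sqrt (real (8 * n))"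
      by (rule of_nat_floor) simp
    finally have "real (card ?P) \<le> sqrt (real (8 * n))" by simp
    moreover have "ln (real (8 * n)) \<ge> 0" using False by simp
    ultimately show ?thesis by (intro mult_right_mono) auto
  qed auto
  finally show ?thesis unfolding eq .
qed

lemma prime_between_large:
  fixes n :: nat
  assumes "n \<ge> 2 ^ 15"
  shows "\<exists>p. prime p \<and> 7 * n < p \<and> p < 8 * n"
proof (rule ccontr)
  assume "\<not> ?thesis"
  hence up: "psi (8 * n) - psi (7 * n) \<le> sqrt (real (8 * n)) * (ln (real (8 * n)) / 2)"
    by (intro psi_diff_le) blast
  \<comment> \<open>In terms of s the estimate becomes a quadratic inequality. The tangent to ln is
    taken at 512, the least possible s, because 8 * 2^15 = 512^2.\<close>
  define s where "s = sqrt (real (8 * n))"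
  have s2: "real (8 * n) = s ^ 2" unfolding s_def by simp
  have "sqrt (512 ^ 2) \<le> s"
    unfolding s_def using assms by (intro real_sqrt_le_mono) simp
  hence s: "s \<ge> 512" by simp
  have "ln (real (8 * n)) = 2 * ln s" using s unfolding s2 by (subst ln_realpow) auto
  also have "ln s \<le> ln 512 + s / 512 - 1" using s by (intro ln_le_tangent) auto
  also have "ln (512 :: real) = ln (2 ^ 9)" by simp
  also have "\<dots> = 9 * ln 2" by (subst ln_realpow) auto
  finally have ln: "ln (real (8 * n)) \<le> 10.48 + s / 256" using ln2_bounds by simp
  define t where "t = s * ((10.48 + s / 256) / 2)"
  have "real (8 * n div 100) \<le> real (8 * n) / 100" using of_nat_div_le_of_nat[of "8 * n" 100] by simp
  hence tail: "psi (8 * n div 100) \<le> 0.12 * real n + 178" using psi_le[of "8 * n div 100"] by simp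
  have "0.41 * real n - 42 * (1 + ln (real (8 * n))) \<le>
      psi (8 * n) - psi (7 * n) + 2 * psi (8 * n div 100)"
    using ln_fact_comb_coeffs_le[of n] ln_fact_comb_coeffs_ge[of n] assms by simp
  also have "\<dots> \<le> s * (ln (real (8 * n)) / 2) + 0.24 * real n + 356"
    using up tail by (simp add: s_def)
  also have "s * (ln (real (8 * n)) / 2) \<le> t"
    unfolding t_def using ln s by (intro mult_left_mono divide_right_mono) auto
  finally have "0.17 * real n \<le> t + 356 + 42 * (1 + (10.48 + s / 256))"
    using ln by simp
  moreover have "t = 5.24 * s + (s * s) / 512" by (simp add: t_def field_simps)
  moreover have "8 * real n = s * s" using s2 by (simp add: power2_eq_square)
  \<comment> \<open>Rounding uses 0.17/8 - 1/512 > 0.019, 5.24 + 42/256 < 5.5 and 356 + 42 * 11.48 <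
    839.\<close>
  ultimately have "0.019 * (s * s) - 5.5 * s \<le> 839" using s by simp
  hence "s * (0.019 * s - 5.5) \<le> 839" by (simp add: algebra_simps)
  moreover have "512 * 4 \<le> s * (0.019 * s - 5.5)" using s by (intro mult_mono) auto
  ultimately show False by simp
qed

section \<open>Small n: trial division and a chain of primes\<close>

function no_odd_divisor_from :: "int \<Rightarrow> int \<Rightarrow> bool" where
  "no_odd_divisor_from d p \<longleftrightarrow>
     (if d \<le> 0 \<or> p < d * d then True else p mod d \<noteq> 0 \<and> no_odd_divisor_from (d + 2) p)"
  by auto
termination
proof (relation "measure (\<lambda>(d, p). nat (p + 1 - d))")
  fix d p :: int
  assume "\<not> (d \<le> 0 \<or> p < d * d)"
  hence d: "0 < d" "d * d \<le> p" by auto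
  have "1 * d \<le> d * d" using d by (intro mult_right_mono) auto
  hence "d \<le> p" using d by linarith
  thus "((d + 2, p), (d, p)) \<in> measure (\<lambda>(d, p). nat (p + 1 - d))" by simp
qed auto

declare no_odd_divisor_from.simps [simp del]

lemma no_odd_divisor_fromD:
  assumes "no_odd_divisor_from d p" "0 < d" "odd d" "odd e" "d \<le> e" "e * e \<le> p"
  shows "\<not> e dvd p"
  using assms
proof (induction d p rule: no_odd_divisor_from.induct)
  case (1 d p)
  have "d * d \<le> e * e" using 1 by (intro mult_mono) auto
  hence *: "\<not> (d \<le> 0 \<or> p < d * d)" using 1 by simp
  hence step: "p mod d \<noteq> 0" "no_odd_divisor_from (d + 2) p"
    using "1.prems"(1) by (simp_all add: no_odd_divisor_from.simps[of d p])
  show ?case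
  proof (cases "e = d")
    case True
    thus ?thesis using step by (simp add: dvd_eq_mod_eq_0)
  next
    case False
    \<comment> \<open>Both are odd, so advancing by 2 skips no candidate.\<close>
    moreover have "e \<noteq> d + 1" using 1 by auto
    ultimately have "d + 2 \<le> e" using 1 by simp
    thus ?thesis using 1 step * by simp
  qed
qed

definition trial_prime :: "int \<Rightarrow> bool" where
  "trial_prime p \<longleftrightarrow> p > 1 \<and> p mod 2 = 1 \<and> no_odd_divisor_from 3 p"

lemma trial_prime_imp_prime:
  assumes "trial_prime p"
  shows "prime (nat p)"
proof (rule ccontr)
  assume "\<not> prime (nat p)"
  moreover have p: "p > 1" "p mod 2 = 1" "no_odd_divisor_from 3 p"
    using assms by (auto simp: trial_prime_def)
  ultimately obtain a where a: "a dvd nat p" "a \<noteq> 1" "a \<noteq> nat p"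
    by (auto simp: prime_nat_iff)
  then obtain b where ab: "nat p = a * b" by blast
  have "nat p \<noteq> 0" using p by simp
  hence "a \<noteq> 0" "b \<noteq> 0" "b \<noteq> 1" using a ab by (metis mult_is_0 mult_1_right)+
  hence gt: "1 < a" "1 < b" using a by auto
  \<comment> \<open>The smaller factor of a composite number has square at most p, so the search
    starting at 3 would have met it.\<close>
  define d where "d = min a b"
  have d: "d dvd nat p" "d > 1" using ab gt by (auto simp: d_def min_def)
  have "d * d \<le> a * b" by (auto simp: d_def intro: mult_le_mono)
  hence "int (d * d) \<le> int (nat p)" using ab by (simp only: of_nat_le_iff)
  hence dd: "int d * int d \<le> p" using p by simp
  have dvd: "int d dvd p" using d(1) p by (simp add: int_dvd_int_iff [symmetric])
  have "odd p" using p(2) by presburger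
  hence odd: "odd (int d)" using dvd by (meson dvd_trans)
  hence "int d \<noteq> 2" by auto
  hence "3 \<le> int d" using d(2) by simp
  thus False using no_odd_divisor_fromD[OF p(3) _ _ odd _ dd] dvd by simp
qed

text \<open>A prime p serves every n with p/8 < n < p/7. The test \<open>p < 8 * l\<close> starts
  this range no later than \<open>l\<close>, and \<open>(p - 1) div 7 + 1\<close> is the first n
  with 7n \<ge> p, where the next prime must take over. The bound \<open>u\<close> is
  exclusive.\<close>

fun prime_chain :: "int \<Rightarrow> int \<Rightarrow> int list \<Rightarrow> bool" where
  "prime_chain l u [] \<longleftrightarrow> u \<le> l"
| "prime_chain l u (p # ps) \<longleftrightarrow> p < 8 * l \<and> trial_prime p \<and> prime_chain ((p - 1) div 7 + 1) u ps"

lemma prime_chain_imp: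
  assumes "prime_chain l u ps" "l \<le> int n" "int n < u"
  shows "\<exists>p. prime p \<and> 7 * n < p \<and> p < 8 * n"
  using assms
proof (induction l u ps rule: prime_chain.induct)
  case (2 l u p ps)
  show ?case
  proof (cases "7 * int n < p")
    case True
    thus ?thesis using 2 trial_prime_imp_prime[of p] by (intro exI[of _ "nat p"]) auto
  next
    case False
    thus ?thesis using 2 by simp
  qed
qed simp

lemma prime_chain_3:
  "prime_chain 3 32768 [23, 31, 37, 47, 53, 61, 71, 83, 89, 103, 113, 131, 151, 173, 199, 229,
     263, 293, 331, 383, 439, 503, 571, 653, 751, 863, 991, 1129, 1291, 1471, 1669, 1907, 2179,
     2477, 2819, 3221, 3677, 4201, 4801, 5483, 6271, 7159, 8179, 9349, 10687, 12211, 13933, 15923,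
     18199, 20789, 23753, 27143, 31019, 35449, 40519, 46309, 52919, 60457, 69073, 78941, 90217,
     103099, 117811, 134639, 153877, 175859, 200983, 229693]"
  by code_simp

theorem corollary2p2p14:
  fixes n :: nat
  assumes "n > 2"
  shows "\<exists>p::nat. prime p \<and> 7 * n < p \<and> p < 8 * n"
proof (cases "n \<ge> 2 ^ 15")
  case True
  thus ?thesis by (rule prime_between_large)
next
  case False
  thus ?thesis using assms by (intro prime_chain_imp[OF prime_chain_3]) auto
qed

end
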